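(* Let $G_0:\mathbb{R}\to(0,1)$ be a continuous strictly increasing bijection. Fix $n\ge1$ and let $\widehat\mu_n:\mathbb{R}^n\to\mathbb{R}$ and $\widehat\sigma_n:\mathbb{R}^n\to(0,\infty)$ be location--scale equivariant, i.e. for all $a>0$, $c\in\mathbb{R}$, $$\widehat\mu_n(aX_1+c,\ldots,aX_n+c)=a\widehat\mu_n(X_1,\ldots,X_n)+c,\qquad \widehat\sigma_n(aX_1+c,\ldots,aX_n+c)=a\widehat\sigma_n(X_1,\ldots,X_n).$$ Define $$\widehat b_n^{\mathrm{ad}}(X_1,\ldots,X_n)=\widehat\mu_n+\widehat\sigma_nG_0^{-1}\left(\frac1n\sum_{i=1}^nG_0\left(\frac{X_i-\widehat\mu_n}{\widehat\sigma_n}\right)\right),$$ where $\widehat\mu_n,\widehat\sigma_n$ are evaluated at $(X_1,\ldots,X_n)$. Then for all $a>0$ and $c\in\mathbb{R}$, $$\widehat b_n^{\mathrm{ad}}(aX_1+c,\ldots,aX_n+c)=a\,\widehat b_n^{\mathrm{ad}}(X_1,\ldots,X_n)+c.$$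
   Context: $\widehat b_n^{\mathrm{ad}}$ is the adaptive probability barycenter: with $G_\theta(x)=G_0((x-\mu)/\sigma)$, $\theta=(\mu,\sigma)$, it equals $G_{\widehat\theta_n}^{-1}\left(\frac1n\sum_{i=1}^n G_{\widehat\theta_n}(X_i)\right)$. The identity is for samples at which $\widehat\mu_n,\widehat\sigma_n$ are defined with $\widehat\sigma_n>0$. *)

theory Defs
  imports "HOL-Analysis.Analysis"
begin

definition affine_sample :: "real \<Rightarrow> real \<Rightarrow> real ^ 'n \<Rightarrow> real ^ 'n"
  where "affine_sample a c X = (\<chi> i. a * X $ i + c)"

text \<open>
  \<open>D\<close> is the set of samples at which both estimators are defined. The equivariance equations
  refer to the estimators at \<open>a X + c\<close>, so they include that \<open>a X + c\<close> lies in \<open>D\<close> again.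
  Taking \<open>D\<close> to be the whole space together with a strictly positive scale estimator would be
  contradictory: at a constant sample \<open>X = (x, \<dots>, x)\<close> the map \<open>2 X - x\<close> fixes \<open>X\<close>, so
  equivariance forces \<open>\<sigma> X = 2 * \<sigma> X\<close>.
\<close>

definition location_scale_equivariant_on ::
  "(real ^ 'n) set \<Rightarrow> (real ^ 'n \<Rightarrow> real) \<Rightarrow> (real ^ 'n \<Rightarrow> real) \<Rightarrow> bool"
  where "location_scale_equivariant_on D \<mu> \<sigma> \<longleftrightarrow>
    (\<forall>X\<in>D. \<forall>a>0. \<forall>c. affine_sample a c X \<in> D \<and>
       \<mu> (affine_sample a c X) = a * \<mu> X + c \<and>
       \<sigma> (affine_sample a c X) = a * \<sigma> X)"

text \<open>
  For \<open>G\<^sub>0\<close> a bijection onto \<open>(0,1)\<close> and \<open>\<sigma> X > 0\<close> the argument of \<open>inv G\<^sub>0\<close> lies in \<open>(0,1)\<close>,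
  hence in the range of \<open>G\<^sub>0\<close>. Samples \<open>X\<close> with \<open>\<sigma> X \<le> 0\<close> carry no meaning here.
\<close>

definition adaptive_barycenter ::
  "(real \<Rightarrow> real) \<Rightarrow> (real ^ 'n \<Rightarrow> real) \<Rightarrow> (real ^ 'n \<Rightarrow> real) \<Rightarrow> real ^ 'n \<Rightarrow> real"
  where "adaptive_barycenter G\<^sub>0 \<mu> \<sigma> X =
    \<mu> X + \<sigma> X * inv G\<^sub>0 (1 / real CARD('n) * (\<Sum>i\<in>UNIV. G\<^sub>0 ((X $ i - \<mu> X) / \<sigma> X)))"

end

theory Submission imports Defs begin

text \<open>The standardized residuals \<open>(X $ i - \<mu> X) / \<sigma> X\<close> are invariant
  under the affine action: the shift cancels in the numerator, the factor \<open>a\<close> in the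
  quotient. So the quantile term is the same number t for both samples, and equivariance passes from
  the estimators to the barycenter: (a \<mu> + c) + a \<sigma> t = a (\<mu> + \<sigma> t) +
  c.\<close>

theorem proposition5p1:
  fixes G\<^sub>0 :: "real \<Rightarrow> real"
    and \<mu> \<sigma> :: "real ^ 'n \<Rightarrow> real"
    and D :: "(real ^ 'n) set"
  assumes "continuous_on UNIV G\<^sub>0"
    and "strict_mono G\<^sub>0"
    and "bij_betw G\<^sub>0 UNIV {0<..<1}"
    and "location_scale_equivariant_on D \<mu> \<sigma>"
  shows "\<forall>X\<in>D. \<sigma> X > 0 \<longrightarrow>
    (\<forall>a>0. \<forall>c. adaptive_barycenter G\<^sub>0 \<mu> \<sigma> (affine_sample a c X)
      = a * adaptive_barycenter G\<^sub>0 \<mu> \<sigma> X + c)"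
proof (intro ballI impI allI)
  fix X a c
  assume X: "X \<in> D" and a: "(a::real) > 0"
  let ?Y = "affine_sample a c X"
  have eq: "\<mu> ?Y = a * \<mu> X + c" "\<sigma> ?Y = a * \<sigma> X"
    using assms(4) X a by (auto simp: location_scale_equivariant_on_def)
  have std: "(?Y $ i - \<mu> ?Y) / \<sigma> ?Y = (X $ i - \<mu> X) / \<sigma> X" for i
  proof -
    have "?Y $ i - \<mu> ?Y = a * (X $ i - \<mu> X)"
      unfolding eq by (simp add: affine_sample_def algebra_simps)
    then show ?thesis
      using a by (simp add: eq)
  qed
  show "adaptive_barycenter G\<^sub>0 \<mu> \<sigma> ?Y = a * adaptive_barycenter G\<^sub>0 \<mu> \<sigma> X + c"
    \<comment> \<open>Rewriting with \<open>std\<close> makes the \<open>inv G\<^sub>0\<close> terms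
      on both sides identical, so they can stay opaque and only a linear identity is left.\<close>
    unfolding adaptive_barycenter_def std by (simp add: eq algebra_simps)
qed

end
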